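(* Let $\mathfrak{r}_{3,-1}$ be the complex Lie algebra on $\mathbb{C}^3$ with canonical basis $\{e_1,e_2,e_3\}$ and nonzero brackets $[e_1,e_2]=e_2$, $[e_1,e_3]=-e_3$. Any hom-Lie algebra $(\mathfrak{r}_{3,-1},A)$ with nilpotent twisting map is isomorphic to some hom-Lie algebra $\mathfrak{L}_4^i:=(\mathfrak{r}_{3,-1},A_i)$, where $A_0$ is the zero map and the matrices of the other $A_i$ with respect to the ordered basis $\{e_1,e_2,e_3\}$ are $$A_1=\begin{pmatrix}0&0&0\\1&0&0\\0&0&0\end{pmatrix},\quad A_2=\begin{pmatrix}0&0&0\\1&0&0\\1&0&0\end{pmatrix},$$ $$A_3=\begin{pmatrix}0&0&0\\0&0&1\\0&0&0\end{pmatrix},\quad A_4(\lambda)=\begin{pmatrix}0&0&0\\0&\lambda&\lambda\\0&-\lambda&-\lambda\end{pmatrix},$$ $$A_5=\begin{pmatrix}0&0&0\\1&0&0\\0&1&0\end{pmatrix},\quad A_6(\lambda)=\begin{pmatrix}0&0&0\\1&\lambda&\lambda\\0&-\lambda&-\lambda\end{pmatrix},$$ where in $A_4(\lambda)$ and $A_6(\lambda)$ the parameter $\lambda\in\mathbb{C}$ satisfies $\lambda\in\mathbb{R}_{>0}$ or $\operatorname{Im}(\lambda)>0$. Moreover, two hom-Lie algebras $(\mathfrak{r}_{3,-1},A_i)$ and $(\mathfrak{r}_{3,-1},A_j)$ in this list (including those with parameter $\lambda$) are isomorphic if and only if their twisting maps are equal, $A_i=A_j$.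
   Context: A complex hom-Lie algebra is a triple $(V,\cdot,A)$, where $V$ is a complex vector space, $\cdot$ is a skew-symmetric bilinear product on $V$, and $A:V\to V$ is a linear map (the twisting map) satisfying the hom-Jacobi identity $$\sum_{\sigma\in S_3}\operatorname{sign}(\sigma)\,Ax_{\sigma(1)}\cdot(x_{\sigma(2)}\cdot x_{\sigma(3)})=0\quad\text{for all }x_1,x_2,x_3\in V.$$ For a Lie algebra $\mathfrak{g}$, a hom-Lie algebra $(\mathfrak{g},A)$ is one whose product is the Lie bracket of $\mathfrak{g}$. An isomorphism of hom-Lie algebras $(V,\cdot,A)\to(U,\ast,B)$ is an invertible linear map $g:V\to U$ with $g(x\cdot y)=(gx)\ast(gy)$ for all $x,y\in V$ and $g\circ A=B\circ g$. In the matrix of a linear map, the $j$-th column is the coordinate vector of the image of $e_j$. *)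

theory Defs
  imports "HOL-Analysis.Analysis" "HOL-Combinatorics.Permutations"
begin

locale hom_lie_algebra = vector_space scale
  for scale :: "complex \<Rightarrow> 'v::ab_group_add \<Rightarrow> 'v" +
  fixes mul :: "'v \<Rightarrow> 'v \<Rightarrow> 'v" and A :: "'v \<Rightarrow> 'v"
  assumes linear_mul_left: "Vector_Spaces.linear scale scale (\<lambda>x. mul x y)"
    and linear_mul_right: "Vector_Spaces.linear scale scale (\<lambda>y. mul x y)"
    and mul_skew: "mul x y = - mul y x"
    and linear_twist: "Vector_Spaces.linear scale scale A"
    and hom_jacobi: "\<And>x :: nat \<Rightarrow> 'v.
      (\<Sum>\<sigma> | \<sigma> permutes {1, 2, 3}.
        scale (of_int (sign \<sigma>)) (mul (A (x (\<sigma> 1))) (mul (x (\<sigma> 2)) (x (\<sigma> 3))))) = 0"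

definition hom_lie_iso ::
  "(complex \<Rightarrow> 'v::ab_group_add \<Rightarrow> 'v) \<Rightarrow> ('v \<Rightarrow> 'v \<Rightarrow> 'v) \<Rightarrow> ('v \<Rightarrow> 'v) \<Rightarrow>
   (complex \<Rightarrow> 'u::ab_group_add \<Rightarrow> 'u) \<Rightarrow> ('u \<Rightarrow> 'u \<Rightarrow> 'u) \<Rightarrow> ('u \<Rightarrow> 'u) \<Rightarrow> ('v \<Rightarrow> 'u) \<Rightarrow> bool" where
  "hom_lie_iso s1 m1 A s2 m2 B g \<longleftrightarrow>
     Vector_Spaces.linear s1 s2 g \<and> bij g \<and>
     (\<forall>x y. g (m1 x y) = m2 (g x) (g y)) \<and> g \<circ> A = B \<circ> g"

definition nilpotent_map :: "('v::zero \<Rightarrow> 'v) \<Rightarrow> bool" where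
  "nilpotent_map A \<longleftrightarrow> (\<exists>k. A ^^ k = (\<lambda>x. 0))"

text \<open>The bilinear skew-symmetric extension of \<open>[e\<^sub>1, e\<^sub>2] = e\<^sub>2\<close>, \<open>[e\<^sub>1, e\<^sub>3] = - e\<^sub>3\<close>,
  \<open>[e\<^sub>2, e\<^sub>3] = 0\<close>, written in coordinates.\<close>

definition r3_bracket :: "complex^3 \<Rightarrow> complex^3 \<Rightarrow> complex^3" where
  "r3_bracket x y = vector [0, x$1 * y$2 - x$2 * y$1, - (x$1 * y$3 - x$3 * y$1)]"

lemma r3_bracket_basis:
  "r3_bracket (axis 1 1) (axis 2 1) = axis 2 1"
  "r3_bracket (axis 1 1) (axis 3 1) = - axis 3 1"
  "r3_bracket (axis 2 1) (axis 3 1) = 0"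
  by (simp_all add: r3_bracket_def vec_eq_iff forall_3 axis_def)

lemma r3_bracket_lie:
  "Vector_Spaces.linear (*s) (*s) (\<lambda>x. r3_bracket x y)"
  "Vector_Spaces.linear (*s) (*s) (\<lambda>y. r3_bracket x y)"
  "r3_bracket x x = 0"
  "r3_bracket x (r3_bracket y z) + r3_bracket y (r3_bracket z x) + r3_bracket z (r3_bracket x y) = 0"
  by (unfold_locales; simp add: r3_bracket_def vec_eq_iff forall_3 algebra_simps)
     (unfold_locales; simp add: r3_bracket_def vec_eq_iff forall_3 algebra_simps
      | simp add: r3_bracket_def vec_eq_iff forall_3 algebra_simps)+

definition A\<^sub>1 :: "complex^3^3" where
  "A\<^sub>1 = vector [vector [0, 0, 0], vector [1, 0, 0], vector [0, 0, 0]]"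

definition A\<^sub>2 :: "complex^3^3" where
  "A\<^sub>2 = vector [vector [0, 0, 0], vector [1, 0, 0], vector [1, 0, 0]]"

definition A\<^sub>3 :: "complex^3^3" where
  "A\<^sub>3 = vector [vector [0, 0, 0], vector [0, 0, 1], vector [0, 0, 0]]"

definition A\<^sub>4 :: "complex \<Rightarrow> complex^3^3" where
  "A\<^sub>4 l = vector [vector [0, 0, 0], vector [0, l, l], vector [0, - l, - l]]"

definition A\<^sub>5 :: "complex^3^3" where
  "A\<^sub>5 = vector [vector [0, 0, 0], vector [1, 0, 0], vector [0, 1, 0]]"

definition A\<^sub>6 :: "complex \<Rightarrow> complex^3^3" where
  "A\<^sub>6 l = vector [vector [0, 0, 0], vector [1, l, l], vector [0, - l, - l]]"

definition admissible :: "complex \<Rightarrow> bool" where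
  "admissible l \<longleftrightarrow> l \<in> complex_of_real ` {0<..} \<or> Im l > 0"

definition L4_twists :: "(complex^3 \<Rightarrow> complex^3) set" where
  "L4_twists =
     {\<lambda>x. 0} \<union> (*v) ` ({A\<^sub>1, A\<^sub>2, A\<^sub>3, A\<^sub>5} \<union> A\<^sub>4 ` Collect admissible \<union> A\<^sub>6 ` Collect admissible)"

end

theory Submission
  imports Defs
begin

text \<open>The bracket sees only the first coordinate of a vector on the abelian ideal
  \<open>\<langle>e\<^sub>2, e\<^sub>3\<rangle>\<close>: \<open>e\<^sub>1\<close> acts there by \<open>diag(1, -1)\<close>. On the basis the hom-Jacobi identity says
  \<open>[Ae\<^sub>2, e\<^sub>3] + [Ae\<^sub>3, e\<^sub>2] = 0\<close>, which means exactly that \<open>A\<close> maps this ideal into itself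
  (\<open>hom_lie_r3_iff\<close>). If \<open>A\<close> is nilpotent as well, then all its eigenvalues vanish, so \<open>A\<close> is given
  by a vector \<open>v = (b, c)\<close>, the image of \<open>e\<^sub>1\<close> in the ideal, and by a nilpotent \<open>2 \<times> 2\<close> block \<open>M\<close>,
  the restriction to the ideal (\<open>nilpotent_twist_block_form\<close>).

  An automorphism of the Lie algebra maps \<open>e\<^sub>1\<close> to \<open>\<epsilon>e\<^sub>1 + w\<close> with \<open>w\<close> in the ideal, and since it
  must respect the weights \<open>1, -1\<close> of \<open>e\<^sub>1\<close>, it either has \<open>\<epsilon> = 1\<close> and rescales \<open>e\<^sub>2, e\<^sub>3\<close>, or has
  \<open>\<epsilon> = -1\<close> and also exchanges the two lines (\<open>bracket_aut_iff\<close>). With \<open>G\<close> its restriction to the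
  ideal, it changes \<open>(v, M)\<close> into \<open>(v', M')\<close> with \<open>M' = GMG\<^sup>-\<^sup>1\<close> and \<open>v' = \<epsilon>(Gv - M'w)\<close>; written in
  coordinates this is \<open>iso_block_twist_iff\<close>, on which the classification rests.

  Hence one first normalises \<open>M\<close> by rescaling and exchanging, and then \<open>v\<close> modulo the image of \<open>M\<close>.
  The block \<open>M = 0\<close> leaves the number of nonzero entries of \<open>v\<close>: this gives \<open>0\<close>, \<open>A\<^sub>1\<close>, \<open>A\<^sub>2\<close>.
  A nonzero block with zero diagonal becomes an elementary matrix, and \<open>v\<close> lies in its image (\<open>A\<^sub>3\<close>)
  or not (\<open>A\<^sub>5\<close>). If the diagonal of \<open>M\<close> is \<open>(p, -p)\<close> with \<open>p \<noteq> 0\<close>, the off-diagonal entries can be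
  scaled to \<open>p\<close> and \<open>-p\<close>, and again \<open>v\<close> lies in the image (\<open>A\<^sub>4\<close>) or not (\<open>A\<^sub>6\<close>). The exchange replaces
  \<open>p\<close> by \<open>-p\<close>, and exactly one of the two is admissible. The same data are invariants, which separates
  the normal forms.\<close>

section \<open>Hom-Lie structures on the Lie algebra\<close>

definition block_twist :: "complex \<Rightarrow> complex \<Rightarrow> complex \<Rightarrow> complex \<Rightarrow> complex \<Rightarrow> complex \<Rightarrow> complex^3^3" where
  "block_twist b c p q r s = vector [vector [0, 0, 0], vector [b, p, q], vector [c, r, s]]"

lemma sum_permutations_3:
  fixes f :: "nat \<Rightarrow> nat \<Rightarrow> nat \<Rightarrow> complex^'n"
  shows "(\<Sum>\<sigma> | \<sigma> permutes {1, 2, 3}. of_int (sign \<sigma>) *s f (\<sigma> 1) (\<sigma> 2) (\<sigma> 3)) =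
    f 1 2 3 + f 2 3 1 + f 3 1 2 - f 1 3 2 - f 3 2 1 - f 2 1 3"
proof -
  have f123: "finite {2, 3::nat}" "1 \<notin> {2, 3::nat}" by auto
  have f23: "finite {3::nat}" "2 \<notin> {3::nat}" by auto
  show ?thesis
    unfolding sum_over_permutations_insert[OF f123] sum_over_permutations_insert[OF f23]
    unfolding permutes_sing
    by (simp add: sign_swap_id permutation_swap_id sign_compose sign_id)
qed

lemma matrix_vector_mult_3:
  fixes M :: "complex^3^3"
  shows "(M *v x) $ i = M$i$1 * x$1 + M$i$2 * x$2 + M$i$3 * x$3"
  by (simp add: matrix_vector_mult_def sum_3)

text \<open>The bracket with \<open>[y, z]\<close> depends on \<open>Ax\<close> only through its first coordinate. Evaluated on the basis,
  the alternating sum is a multiple of \<open>(0, M\<^sub>1\<^sub>3, -M\<^sub>1\<^sub>2)\<close>; if both entries vanish, that coordinate is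
  \<open>M\<^sub>1\<^sub>1 x\<^sub>1\<close>, and the identity reduces to the Jacobi identity of the bracket.\<close>

lemma hom_lie_r3_iff:
  fixes M :: "complex^3^3"
  shows "hom_lie_algebra (*s) r3_bracket ((*v) M) \<longleftrightarrow> M$1$2 = 0 \<and> M$1$3 = 0"
proof
  assume h: "hom_lie_algebra (*s) r3_bracket ((*v) M)"
  define x :: "nat \<Rightarrow> complex^3" where
    "x i = (if i = 1 then axis 1 1 else if i = 2 then axis 2 1 else axis 3 1)" for i
  have x: "x 1 = axis 1 1" "x 2 = axis 2 1" "x 3 = axis 3 1" by (simp_all add: x_def)
  have "(\<Sum>\<sigma> | \<sigma> permutes {1, 2, 3}. of_int (sign \<sigma>) *s
      r3_bracket (M *v x (\<sigma> 1)) (r3_bracket (x (\<sigma> 2)) (x (\<sigma> 3)))) = 0"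
    using h by (rule hom_lie_algebra.hom_jacobi)
  then show "M$1$2 = 0 \<and> M$1$3 = 0"
    unfolding sum_permutations_3[of "\<lambda>i j k. r3_bracket (M *v x i) (r3_bracket (x j) (x k))"] x
    by (simp add: r3_bracket_def vec_eq_iff forall_3 matrix_vector_mult_3 axis_def)
next
  assume M: "M$1$2 = 0 \<and> M$1$3 = 0"
  have "(\<Sum>\<sigma> | \<sigma> permutes {1, 2, 3}. of_int (sign \<sigma>) *s
      r3_bracket (M *v x (\<sigma> 1)) (r3_bracket (x (\<sigma> 2)) (x (\<sigma> 3)))) = 0" for x :: "nat \<Rightarrow> complex^3"
    unfolding sum_permutations_3[of "\<lambda>i j k. r3_bracket (M *v x i) (r3_bracket (x j) (x k))"]
    by (simp add: r3_bracket_def vec_eq_iff forall_3 matrix_vector_mult_3 M) (simp add: algebra_simps)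
  then show "hom_lie_algebra (*s) r3_bracket ((*v) M)"
    by (intro hom_lie_algebra.intro hom_lie_algebra_axioms.intro r3_bracket_lie vec.vector_space_axioms
       matrix_vector_mul_linear_gen)
      (simp_all add: r3_bracket_def vec_eq_iff forall_3)
qed

lemma nilpotent_map_eigenvalue_zero:
  fixes M :: "complex^3^3"
  assumes "nilpotent_map ((*v) M)" and d: "det (M - mat \<mu>) = 0"
  shows "\<mu> = 0"
proof -
  obtain k where k: "((*v) M ^^ k) = (\<lambda>x. 0)" using assms by (auto simp: nilpotent_map_def)
  have "\<not> (\<forall>x. (M - mat \<mu>) *v x = 0 \<longrightarrow> x = 0)"
    using d invertible_det_nz[of "M - mat \<mu>"]  matrix_left_invertible_ker[of "M - mat \<mu>"]
    by (auto simp: invertible_left_inverse)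
  then obtain v where "(M - mat \<mu>) *v v = 0" and v0: "v \<noteq> 0" by auto
  then have v: "M *v v = \<mu> *s v"
    by (simp add: vec_eq_iff forall_3 matrix_vector_mult_3 mat_def algebra_simps)
  have "((*v) M ^^ n) v = \<mu> ^ n *s v" for n
    by (induction n) (simp_all add: vector_scalar_commute v)
  from this[of k] k v0 show ?thesis by (simp add: vec_eq_iff) auto
qed

text \<open>The characteristic polynomial of the twist splits into the linear factor of \<open>M\<^sub>1\<^sub>1\<close> and the
  quadratic one of the block. All roots being \<open>0\<close>, the trace and the determinant of the block vanish.\<close>

lemma nilpotent_twist_block_form:
  assumes h: "hom_lie_algebra (*s) r3_bracket A" and n: "nilpotent_map A"
  obtains b c p q r where "A = (*v) (block_twist b c p q r (-p))" "p^2 + q * r = 0"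
proof -
  define M where "M = matrix A"
  have lin: "Vector_Spaces.linear (*s) (*s) A" using h by (rule hom_lie_algebra.linear_twist)
  have A: "A = (*v) M" unfolding M_def by (rule ext) (simp add: matrix_works[OF lin])
  have z: "M$1$2 = 0" "M$1$3 = 0" using h unfolding A hom_lie_r3_iff by auto
  define p q r s where "p = M$2$2" and "q = M$2$3" and "r = M$3$2" and "s = M$3$3"
  have cp: "det (M - mat t) = (M$1$1 - t) * (t^2 - (p + s) * t + (p * s - q * r))" for t
    unfolding det_3 by (simp add: mat_def z p_def q_def r_def s_def power2_eq_square algebra_simps)
  have root: "t = 0" if "(M$1$1 - t) * (t^2 - (p + s) * t + (p * s - q * r)) = 0" for t
    using nilpotent_map_eigenvalue_zero[of M t] n that cp unfolding A by simp
  have "M$1$1 = 0" using root[of "M$1$1"] by simp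
  \<comment> \<open>The square root of the discriminant, so that the quadratic factor splits.\<close>
  define D where "D = csqrt ((p - s)^2 + 4 * q * r)"
  have D: "D^2 = (p - s)^2 + 4 * q * r" by (simp add: D_def)
  have quad: "t^2 - (p + s) * t + (p * s - q * r) = (t - (p + s + D) / 2) * (t - (p + s - D) / 2)" for t
    using D by (simp add: field_simps power2_eq_square)
  have "p + s + D = 0" "p + s - D = 0"
    using root[of "(p + s + D) / 2"] root[of "(p + s - D) / 2"] unfolding quad by auto
  then have "2 * (p + s) = 0" "D = 0" by algebra+
  then have s: "s = -p" by (simp add: add_eq_0_iff2)
  with D \<open>D = 0\<close> have "p^2 + q * r = 0" by (simp add: power2_eq_square) algebra
  moreover have "A = (*v) (block_twist (M$2$1) (M$3$1) p q r (-p))"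
    unfolding A block_twist_def using z \<open>M$1$1 = 0\<close> s[symmetric]
    by (intro arg_cong[of _ _ "(*v)"]) (simp add: vec_eq_iff forall_3 p_def q_def r_def s_def)
  ultimately show thesis using that by blast
qed

section \<open>Automorphisms and their action on twists\<close>

definition iso_twists :: "complex^3^3 \<Rightarrow> complex^3^3 \<Rightarrow> bool" where
  "iso_twists M N \<longleftrightarrow> (\<exists>g. hom_lie_iso (*s) r3_bracket ((*v) M) (*s) r3_bracket ((*v) N) g)"

definition diag_aut :: "complex \<Rightarrow> complex \<Rightarrow> complex \<Rightarrow> complex \<Rightarrow> complex^3^3" where
  "diag_aut x y \<alpha> \<beta> = vector [vector [1, 0, 0], vector [x, \<alpha>, 0], vector [y, 0, \<beta>]]"

definition swap_aut :: "complex \<Rightarrow> complex \<Rightarrow> complex \<Rightarrow> complex \<Rightarrow> complex^3^3" where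
  "swap_aut x y \<alpha> \<beta> = vector [vector [-1, 0, 0], vector [x, 0, \<alpha>], vector [y, \<beta>, 0]]"

text \<open>The image of \<open>e\<^sub>2\<close> and of \<open>e\<^sub>3\<close> lies in the derived algebra \<open>\<langle>e\<^sub>2, e\<^sub>3\<rangle>\<close>. Comparing
  \<open>[Ge\<^sub>1, Ge\<^sub>2] = Ge\<^sub>2\<close> and \<open>[Ge\<^sub>1, Ge\<^sub>3] = -Ge\<^sub>3\<close> componentwise shows that \<open>G\<^sub>1\<^sub>1 = 1\<close> kills the
  off-diagonal entries on this plane, \<open>G\<^sub>1\<^sub>1 = -1\<close> kills the diagonal ones, and any other value
  makes \<open>G\<close> singular.\<close>

lemma bracket_aut_iff:
  fixes G :: "complex^3^3"
  shows "bij ((*v) G) \<and> (\<forall>x y. G *v r3_bracket x y = r3_bracket (G *v x) (G *v y)) \<longleftrightarrow>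
    (\<exists>x y \<alpha> \<beta>. \<alpha> \<noteq> 0 \<and> \<beta> \<noteq> 0 \<and> (G = diag_aut x y \<alpha> \<beta> \<or> G = swap_aut x y \<alpha> \<beta>))"
    (is "?L \<longleftrightarrow> ?R")
proof
  assume L: ?L
  have br: "G *v r3_bracket x y = r3_bracket (G *v x) (G *v y)" for x y using L by blast
  have d: "det G \<noteq> 0"
    using L by (simp add: invertible_det_nz[symmetric] invertible_eq_bij)
  note simps = r3_bracket_def vec_eq_iff forall_3 matrix_vector_mult_3 axis_def
  have z: "G$1$2 = 0" "G$1$3 = 0"
    using br[of "axis 1 1" "axis 2 1"] br[of "axis 1 1" "axis 3 1"] by (simp_all add: simps)
  have "G$2$2 = G$1$1 * G$2$2" "G$3$2 = - (G$1$1 * G$3$2)"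
    using br[of "axis 1 1" "axis 2 1"] z by (simp_all add: simps)
  moreover have "- G$2$3 = G$1$1 * G$2$3" "G$3$3 = G$1$1 * G$3$3"
    using br[of "axis 1 1" "axis 3 1"] z by (simp_all add: simps)
  ultimately have e: "(G$1$1 - 1) * G$2$2 = 0" "(G$1$1 + 1) * G$3$2 = 0"
    "(G$1$1 + 1) * G$2$3 = 0" "(G$1$1 - 1) * G$3$3 = 0"
    by algebra+
  have D: "G$1$1 * (G$2$2 * G$3$3 - G$2$3 * G$3$2) \<noteq> 0"
    using d z by (simp add: det_3 algebra_simps)
  consider "G$1$1 = 1" | "G$1$1 = -1"
    using e D by (auto simp: add_eq_0_iff2)
  then show ?R
  proof cases
    case 1
    then have "G = diag_aut (G$2$1) (G$3$1) (G$2$2) (G$3$3)" "G$2$2 \<noteq> 0" "G$3$3 \<noteq> 0"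
      using e D z by (simp_all add: diag_aut_def vec_eq_iff forall_3)
    then show ?thesis by blast
  next
    case 2
    then have "G = swap_aut (G$2$1) (G$3$1) (G$2$3) (G$3$2)" "G$2$3 \<noteq> 0" "G$3$2 \<noteq> 0"
      using e D z by (simp_all add: swap_aut_def vec_eq_iff forall_3)
    then show ?thesis by blast
  qed
next
  assume ?R
  then obtain x y \<alpha> \<beta> where "\<alpha> \<noteq> 0" "\<beta> \<noteq> 0" and G: "G = diag_aut x y \<alpha> \<beta> \<or> G = swap_aut x y \<alpha> \<beta>"
    by blast
  then have "det G \<noteq> 0" by (auto simp: det_3 diag_aut_def swap_aut_def)
  moreover have "G *v r3_bracket u v = r3_bracket (G *v u) (G *v v)" for u v
    using G by (auto simp: r3_bracket_def vec_eq_iff forall_3 matrix_vector_mult_3 diag_aut_def swap_aut_def algebra_simps)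
  ultimately show ?L by (simp add: invertible_det_nz[symmetric] invertible_eq_bij)
qed

lemma iso_twists_iff_aut:
  "iso_twists M N \<longleftrightarrow> (\<exists>x y \<alpha> \<beta>. \<alpha> \<noteq> 0 \<and> \<beta> \<noteq> 0 \<and>
     (diag_aut x y \<alpha> \<beta> ** M = N ** diag_aut x y \<alpha> \<beta> \<or>
      swap_aut x y \<alpha> \<beta> ** M = N ** swap_aut x y \<alpha> \<beta>))"
proof -
  have "hom_lie_iso (*s) r3_bracket ((*v) M) (*s) r3_bracket ((*v) N) ((*v) G) \<longleftrightarrow>
     (bij ((*v) G) \<and> (\<forall>x y. G *v r3_bracket x y = r3_bracket (G *v x) (G *v y))) \<and> G ** M = N ** G" for G
    unfolding hom_lie_iso_def using matrix_vector_mul_linear_gen[of G]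
    by (simp add: fun_eq_iff matrix_vector_mul_assoc matrix_eq)
  moreover have "\<exists>G. g = (*v) G" if "hom_lie_iso (*s) r3_bracket ((*v) M) (*s) r3_bracket ((*v) N) g" for g
  proof
    show "g = (*v) (matrix g)"
      using that by (simp add: hom_lie_iso_def matrix_works fun_eq_iff)
  qed
  ultimately have "iso_twists M N \<longleftrightarrow> (\<exists>G. (bij ((*v) G) \<and>
      (\<forall>x y. G *v r3_bracket x y = r3_bracket (G *v x) (G *v y))) \<and> G ** M = N ** G)"
    unfolding iso_twists_def by metis
  then show ?thesis unfolding bracket_aut_iff by blast
qed

text \<open>The alternatives come from \<open>diag_aut\<close> (\<open>\<epsilon> = 1\<close>) and \<open>swap_aut\<close> (\<open>\<epsilon> = -1\<close>). The last two
  equations of each read \<open>Gv = \<epsilon>v' + M'w\<close>, where \<open>v = (b, c)\<close>, \<open>v' = (b', c')\<close>, \<open>w = (x, y)\<close>, and \<open>M'\<close> is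
  the block of the second twist: up to the action of \<open>G\<close>, only the class of \<open>v\<close> modulo the image of the
  block matters.\<close>

lemma iso_block_twist_iff:
  "iso_twists (block_twist b c p q r s) (block_twist b' c' p' q' r' s') \<longleftrightarrow>
     (\<exists>x y \<alpha> \<beta>. \<alpha> \<noteq> 0 \<and> \<beta> \<noteq> 0 \<and>
       (p' = p \<and> s' = s \<and> \<alpha> * q = q' * \<beta> \<and> \<beta> * r = r' * \<alpha> \<and>
        \<alpha> * b = b' + p' * x + q' * y \<and> \<beta> * c = c' + r' * x + s' * y \<or>
        p' = s \<and> s' = p \<and> \<alpha> * r = q' * \<beta> \<and> \<beta> * q = r' * \<alpha> \<and>
        \<alpha> * c = - b' + p' * x + q' * y \<and> \<beta> * b = - c' + r' * x + s' * y))"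
proof -
  note simps = vec_eq_iff forall_3 matrix_matrix_mult_def sum_3 diag_aut_def swap_aut_def block_twist_def
  have "diag_aut x y \<alpha> \<beta> ** block_twist b c p q r s = block_twist b' c' p' q' r' s' ** diag_aut x y \<alpha> \<beta> \<longleftrightarrow>
       p' = p \<and> s' = s \<and> \<alpha> * q = q' * \<beta> \<and> \<beta> * r = r' * \<alpha> \<and>
        \<alpha> * b = b' + p' * x + q' * y \<and> \<beta> * c = c' + r' * x + s' * y"
    if "\<alpha> \<noteq> 0" "\<beta> \<noteq> 0" for x y \<alpha> \<beta>
  proof -
    have "\<alpha> * p = p' * \<alpha> \<longleftrightarrow> p' = p" "\<beta> * s = s' * \<beta> \<longleftrightarrow> s' = s" using that by auto
    then show ?thesis unfolding simps by simp blast
  qed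
  moreover have "swap_aut x y \<alpha> \<beta> ** block_twist b c p q r s = block_twist b' c' p' q' r' s' ** swap_aut x y \<alpha> \<beta> \<longleftrightarrow>
        p' = s \<and> s' = p \<and> \<alpha> * r = q' * \<beta> \<and> \<beta> * q = r' * \<alpha> \<and>
        \<alpha> * c = - b' + p' * x + q' * y \<and> \<beta> * b = - c' + r' * x + s' * y"
    if "\<alpha> \<noteq> 0" "\<beta> \<noteq> 0" for x y \<alpha> \<beta>
  proof -
    have "\<alpha> * s = p' * \<alpha> \<longleftrightarrow> p' = s" "\<beta> * p = s' * \<beta> \<longleftrightarrow> s' = p" using that by auto
    then show ?thesis unfolding simps by simp blast
  qed
  ultimately show ?thesis unfolding iso_twists_iff_aut by (simp cong: conj_cong)
qed

section \<open>Normal forms\<close>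

lemma A_block_twist: "A\<^sub>1 = block_twist 1 0 0 0 0 0" "A\<^sub>2 = block_twist 1 1 0 0 0 0" "A\<^sub>3 = block_twist 0 0 0 1 0 0"
  "A\<^sub>4 l = block_twist 0 0 l l (-l) (-l)" "A\<^sub>5 = block_twist 1 0 0 0 1 0" "A\<^sub>6 l = block_twist 1 0 l l (-l) (-l)"
  by (simp_all add: block_twist_def A\<^sub>1_def A\<^sub>2_def A\<^sub>3_def A\<^sub>4_def A\<^sub>5_def A\<^sub>6_def)

text \<open>A matrix in place of the map that it induces, so that two normal forms can be compared entry by entry.\<close>

definition normal_forms :: "(complex^3^3) set" where
  "normal_forms = {block_twist 0 0 0 0 0 0, A\<^sub>1, A\<^sub>2, A\<^sub>3, A\<^sub>5} \<union> A\<^sub>4 ` Collect admissible \<union> A\<^sub>6 ` Collect admissible"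

lemma L4_twists_eq: "L4_twists = (*v) ` normal_forms"
proof -
  have "(*v) (block_twist 0 0 0 0 0 0) = (\<lambda>x. 0)"
    by (simp add: fun_eq_iff vec_eq_iff forall_3 matrix_vector_mult_3 block_twist_def)
  then show ?thesis by (auto simp: L4_twists_def normal_forms_def)
qed

lemma admissible_nonzero: "admissible l \<Longrightarrow> l \<noteq> 0"
  by (auto simp: admissible_def)

text \<open>The admissible numbers form a half-plane together with half of its boundary line: a set of
  representatives of the nonzero numbers modulo sign.\<close>

lemma admissible_neg: "l \<noteq> 0 \<Longrightarrow> admissible (- l) \<longleftrightarrow> \<not> admissible l"
proof -
  assume "l \<noteq> 0"
  have "z \<in> complex_of_real ` {0<..} \<longleftrightarrow> Im z = 0 \<and> Re z > 0" for z
  proof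
    assume "Im z = 0 \<and> Re z > 0"
    then show "z \<in> complex_of_real ` {0<..}"
      by (intro image_eqI[of _ _ "Re z"]) (simp_all add: complex_eq_iff)
  qed auto
  then have "admissible z \<longleftrightarrow> Im z > 0 \<or> Im z = 0 \<and> Re z > 0" for z
    by (auto simp: admissible_def)
  moreover have "Re l \<noteq> 0 \<or> Im l \<noteq> 0" using \<open>l \<noteq> 0\<close> by (simp add: complex_eq_iff)
  ultimately show ?thesis by (simp add: less_le) linarith
qed

lemma iso_twists_trans: "iso_twists L M \<Longrightarrow> iso_twists M N \<Longrightarrow> iso_twists L N"
  unfolding iso_twists_def hom_lie_iso_def
proof (elim exE conjE)
  fix g h
  assume "Vector_Spaces.linear (*s) (*s) g" "Vector_Spaces.linear (*s) (*s) h" "bij g" "bij h"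
   and gh: "\<forall>x y. g (r3_bracket x y) = r3_bracket (g x) (g y)" "\<forall>x y. h (r3_bracket x y) = r3_bracket (h x) (h y)"
    "g \<circ> (*v) L = (*v) M \<circ> g" "h \<circ> (*v) M = (*v) N \<circ> h"
  then have "Vector_Spaces.linear (*s) (*s) (h \<circ> g)" "bij (h \<circ> g)"
    by (auto intro: Vector_Spaces.linear_compose bij_comp)
  moreover have "h \<circ> g \<circ> (*v) L = (*v) N \<circ> (h \<circ> g)"
    using gh(3,4) by (metis comp_assoc)
  ultimately show "\<exists>g. Vector_Spaces.linear (*s) (*s) g \<and> bij g \<and>
      (\<forall>x y. g (r3_bracket x y) = r3_bracket (g x) (g y)) \<and> g \<circ> (*v) L = (*v) N \<circ> g"
    using gh(1,2) by (intro exI[of _ "h \<circ> g"]) simp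
qed

text \<open>The automorphism \<open>e\<^sub>1 \<mapsto> -e\<^sub>1, e\<^sub>2 \<leftrightarrow> e\<^sub>3\<close>. It halves the cases in the search for a normal form.\<close>

lemma iso_block_twist_swap: "iso_twists (block_twist b c p q r s) (block_twist (-c) (-b) s r q p)"
  unfolding iso_block_twist_iff
  by (intro exI[of _ 0] exI[of _ 1]) simp

text \<open>When the block is zero, \<open>v\<close> can only be rescaled entrywise and, by the exchange, permuted. The
  hypothesis leaves out \<open>v = (0, c)\<close>, which the exchange turns into \<open>(-c, 0)\<close>.\<close>

lemma normal_form_zero_block:
  assumes "b \<noteq> 0 \<or> c = 0"
  shows "\<exists>N \<in> normal_forms. iso_twists (block_twist b c 0 0 0 0) N"
proof -
  consider "b = 0" "c = 0" | "b \<noteq> 0" "c = 0" | "b \<noteq> 0" "c \<noteq> 0" using assms by blast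
  then show ?thesis
  proof cases
    case 1
    then have "iso_twists (block_twist b c 0 0 0 0) (block_twist 0 0 0 0 0 0)"
      unfolding iso_block_twist_iff by (intro exI[of _ 1]) simp
    then show ?thesis by (auto simp: normal_forms_def)
  next
    case 2
    then have "iso_twists (block_twist b c 0 0 0 0) A\<^sub>1"
      unfolding iso_block_twist_iff A_block_twist by (intro exI[of _ 0] exI[of _ "1/b"] exI[of _ 1]) simp
    then show ?thesis by (auto simp: normal_forms_def)
  next
    case 3
    then have "iso_twists (block_twist b c 0 0 0 0) A\<^sub>2"
      unfolding iso_block_twist_iff A_block_twist by (intro exI[of _ 0] exI[of _ "1/b"] exI[of _ "1/c"]) simp
    then show ?thesis by (auto simp: normal_forms_def)
  qed
qed

text \<open>The image of the block is \<open>\<langle>e\<^sub>2\<rangle>\<close>, so \<open>b\<close> can be removed and only the vanishing of \<open>c\<close> matters.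
  The block of \<open>A\<^sub>5\<close> is lower triangular, hence the isomorphism for \<open>c \<noteq> 0\<close> is an exchanging one.\<close>

lemma normal_form_upper_block:
  assumes "q \<noteq> 0"
  shows "\<exists>N \<in> normal_forms. iso_twists (block_twist b c 0 q 0 0) N"
proof (cases "c = 0")
  case True
  have "iso_twists (block_twist b c 0 q 0 0) A\<^sub>3"
    unfolding A_block_twist iso_block_twist_iff using assms True
    by (intro exI[of _ 0] exI[of _ "b / q"] exI[of _ "1/q"] exI[of _ 1]) simp
  then show ?thesis by (auto simp: normal_forms_def)
next
  case False
  have "iso_twists (block_twist b c 0 q 0 0) A\<^sub>5"
    unfolding A_block_twist iso_block_twist_iff using assms False
    by (intro exI[of _ "- b / (c*q)"] exI[of _ 0] exI[of _ "- 1/c"] exI[of _ "- 1/(c*q)"]) simp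
  then show ?thesis by (auto simp: normal_forms_def)
qed

text \<open>Rescaling with \<open>\<alpha> q = p \<beta>\<close> makes all entries of the block \<open>\<plusminus>p\<close>. Then the image of the block is
  \<open>\<langle>(1, -1)\<rangle>\<close>, so what remains of \<open>v\<close> is the sum of its rescaled entries \<open>\<alpha> b + \<beta> c = (p b + q c) \<beta> / q\<close>,
  which is \<open>0\<close> or can be scaled to \<open>1\<close>.\<close>

lemma normal_form_admissible_block:
  assumes p: "admissible p" and pqr: "p^2 + q * r = 0"
  shows "\<exists>N \<in> normal_forms. iso_twists (block_twist b c p q r (-p)) N"
proof -
  have nz: "p \<noteq> 0" "q \<noteq> 0" using admissible_nonzero[OF p] pqr by auto
  have r: "r = - p\<^sup>2 / q" using pqr nz by (simp add: field_simps eq_neg_iff_add_eq_0)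
  \<comment> \<open>The vector \<open>(b, c)\<close> lies in the image of the block, spanned by \<open>(q, -p)\<close>, precisely when \<open>d = 0\<close>.\<close>
  define d where "d = p * b + q * c"
  have c: "c = (d - p * b) / q" using nz by (simp add: d_def)
  show ?thesis
  proof (cases "d = 0")
    case True
    have "iso_twists (block_twist b c p q r (-p)) (A\<^sub>4 p)"
      unfolding A_block_twist iso_block_twist_iff using nz True unfolding r c
      by (intro exI[of _ "b / q"] exI[of _ 0] exI[of _ "p / q"] exI[of _ 1])
        (simp add: power2_eq_square)
    then show ?thesis using p by (auto simp: normal_forms_def)
  next
    case False
    \<comment> \<open>\<open>\<beta> = q / d\<close> makes the sum of the entries of \<open>v\<close> equal to \<open>1\<close>, and \<open>x\<close> then clears the second entry.\<close>
    have "iso_twists (block_twist b c p q r (-p)) (A\<^sub>6 p)"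
      unfolding A_block_twist iso_block_twist_iff using nz False unfolding r c
      by (intro exI[of _ "- (d - p * b) / (d * p)"] exI[of _ 0] exI[of _ "p / d"] exI[of _ "q / d"])
        (simp add: power2_eq_square field_simps)
    then show ?thesis using p by (auto simp: normal_forms_def)
  qed
qed

lemma normal_form_exists:
  assumes "p^2 + q * r = 0"
  shows "\<exists>N \<in> normal_forms. iso_twists (block_twist b c p q r (-p)) N"
proof -
  have swap: ?thesis if "\<exists>N \<in> normal_forms. iso_twists (block_twist (-c) (-b) (-p) r q p) N"
    using that iso_twists_trans[OF iso_block_twist_swap[of b c p q r "-p"]] by blast
  consider "p = 0" "q = 0" "r = 0" | "p = 0" "q \<noteq> 0" "r = 0" | "p = 0" "q = 0" "r \<noteq> 0"
    | "admissible p" | "admissible (- p)"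
    using assms admissible_neg[of p] by (cases "p = 0") auto
  then show ?thesis
  proof cases
    case 1
    then show ?thesis
      using normal_form_zero_block[of b c] normal_form_zero_block[of "-c" "-b"] swap by (cases "b = 0 \<and> c \<noteq> 0") auto
  next
    case 2
    then show ?thesis using normal_form_upper_block[of q b c] by simp
  next
    case 3
    then show ?thesis using normal_form_upper_block[of r "-c" "-b"] swap by simp
  next
    case 4
    then show ?thesis using assms by (rule normal_form_admissible_block)
  next
    case 5
    then show ?thesis using normal_form_admissible_block[of "-p" r q "-c" "-b"] swap assms by (simp add: mult.commute)
  qed
qed

lemma normal_forms_cases:
  assumes "M \<in> normal_forms"
  obtains (rigid) b c q r where "M = block_twist b c 0 q r 0"
      "(b, c, q, r) \<in> {(0,0,0,0), (1,0,0,0), (1,1,0,0), (0,0,1,0), (1,0,0,1)}"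
    | (family) l b where "M = block_twist b 0 l l (-l) (-l)" "admissible l" "b \<in> {0, 1}"
  using assms unfolding normal_forms_def A_block_twist
  by (elim UnE insertE imageE emptyE; simp only: mem_Collect_eq) (use that in \<open>blast+\<close>)

text \<open>The diagonal of the block is determined up to the exchange, so the parameter is determined up to
  sign, hence by admissibility. Given the parameter, \<open>b\<close> is \<open>0\<close> or \<open>1\<close> according to whether \<open>v\<close> lies in
  the image of the block. Among the normal forms with zero diagonal, the cases are
  separated by whether the block vanishes, whether \<open>v\<close> lies in its image, and, for the zero block, by the
  number of nonzero entries of \<open>v\<close>.\<close>

lemma normal_form_unique:
  assumes "M \<in> normal_forms" "N \<in> normal_forms" "iso_twists M N"
  shows "M = N"
  using assms(1)
proof (cases rule: normal_forms_cases)
  case M: (rigid b c q r)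
  from assms(2) show ?thesis
  proof (cases rule: normal_forms_cases)
    case N: (rigid b' c' q' r')
    obtain x y \<alpha> \<beta> where nz: "\<alpha> \<noteq> 0" "\<beta> \<noteq> 0" and eqs:
      "\<alpha> * q = q' * \<beta> \<and> \<beta> * r = r' * \<alpha> \<and> \<alpha> * b = b' + q' * y \<and> \<beta> * c = c' + r' * x \<or>
       \<alpha> * r = q' * \<beta> \<and> \<beta> * q = r' * \<alpha> \<and> \<alpha> * c = - b' + q' * y \<and> \<beta> * b = - c' + r' * x"
      using assms(3) unfolding M(1) N(1) iso_block_twist_iff by auto
    have "b = b' \<and> c = c' \<and> q = q' \<and> r = r'"
      using M(2) N(2) eqs nz
      by (simp only: insert_iff empty_iff prod.inject) (elim disjE conjE; simp)
    then show ?thesis using M N by simp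
  next
    case N: (family l b')
    then have "l = 0" using assms(3) unfolding M(1) N(1) iso_block_twist_iff by blast
    then show ?thesis using N(2) admissible_nonzero by blast
  qed
next
  case M: (family l b)
  then have "l \<noteq> 0" using admissible_nonzero by blast
  from assms(2) show ?thesis
  proof (cases rule: normal_forms_cases)
    case N: (rigid b' c' q' r')
    then have "l = 0" using assms(3) unfolding M(1) N(1) iso_block_twist_iff by auto
    then show ?thesis using \<open>l \<noteq> 0\<close> by blast
  next
    case N: (family l' b')
    have "l' \<noteq> - l" using M(2) N(2) admissible_neg[OF \<open>l \<noteq> 0\<close>] by blast
    then obtain x y \<alpha> \<beta> where "\<alpha> \<noteq> 0" and l: "l' = l"
      and "\<alpha> * b = b' + l * x + l * y" "0 = - l * x - l * y"
      using assms(3) unfolding M(1) N(1) iso_block_twist_iff by auto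
    \<comment> \<open>Adding the two equations removes the image of the block.\<close>
    from this(3,4) have "\<alpha> * b = b'" by algebra
    with \<open>\<alpha> \<noteq> 0\<close> have "b = b'" using M(3) N(3) by auto
    then show ?thesis unfolding M(1) N(1) l by simp
  qed
qed

theorem proposition3p5:
  "(\<forall>B \<in> L4_twists. hom_lie_algebra (*s) r3_bracket B) \<and>
   (\<forall>A. hom_lie_algebra (*s) r3_bracket A \<and> nilpotent_map A \<longrightarrow>
      (\<exists>B \<in> L4_twists. \<exists>g. hom_lie_iso (*s) r3_bracket A (*s) r3_bracket B g)) \<and>
   (\<forall>B \<in> L4_twists. \<forall>C \<in> L4_twists.
      (\<exists>g. hom_lie_iso (*s) r3_bracket B (*s) r3_bracket C g) \<longleftrightarrow> B = C)"
proof (intro conjI ballI allI impI)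
  fix B assume "B \<in> L4_twists"
  then obtain M where "B = (*v) M" "M \<in> normal_forms" unfolding L4_twists_eq by blast
  then show "hom_lie_algebra (*s) r3_bracket B"
    by (auto simp: hom_lie_r3_iff normal_forms_def A_block_twist block_twist_def)
next
  fix A assume "hom_lie_algebra (*s) r3_bracket A \<and> nilpotent_map A"
  then obtain b c p q r where "A = (*v) (block_twist b c p q r (-p))" "p^2 + q * r = 0"
    using nilpotent_twist_block_form by blast
  then show "\<exists>B \<in> L4_twists. \<exists>g. hom_lie_iso (*s) r3_bracket A (*s) r3_bracket B g"
    using normal_form_exists[of p q r b c] unfolding L4_twists_eq iso_twists_def by blast
next
  fix B C assume "B \<in> L4_twists" "C \<in> L4_twists"
  then obtain M N where MN: "M \<in> normal_forms" "N \<in> normal_forms" "B = (*v) M" "C = (*v) N"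
    unfolding L4_twists_eq by blast
  have "iso_twists M M"
    unfolding iso_twists_def hom_lie_iso_def by (intro exI[of _ id]) (simp add: vec.linear_id)
  then show "(\<exists>g. hom_lie_iso (*s) r3_bracket B (*s) r3_bracket C g) \<longleftrightarrow> B = C"
    using normal_form_unique[OF MN(1,2)] MN(3,4) unfolding iso_twists_def by blast
qed

end
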